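(* Let $(B,\rho,u,\phi)$ be a sufficiently smooth solution on $\Omega\times[0,\infty)$, $\Omega=[a,b]$, with periodic boundary conditions in $x$, of the system $$\begin{cases} B_t = \mathrm{i}\big(\omega B_{xx}-\kappa\big(u-\tfrac12\nu\rho+q\phi\big)B\big),\\ \rho_t=\partial_x\big(-u+\nu\rho-\kappa\phi\big),\\ u_t=\partial_x\big(-\beta\rho+\nu u+\tfrac12\kappa\nu\phi\big),\\ \phi_t=2\,\mathrm{Re}(\bar B\, B_t),\end{cases}\qquad x\in\Omega,\ t\ge 0,$$ with initial conditions $B(x,0)=B_0(x)$, $\rho(x,0)=\rho_0(x)$, $u(x,0)=u_0(x)$, $\phi(x,0)=|B_0(x)|^2$ for $x\in\Omega$. Then the mass $\mathcal{M}(t)=\int_\Omega|B|^2\,dx$ and the two linear functionals $\mathcal{I}_1(t)=\int_\Omega\rho\,dx$ and $\mathcal{I}_2(t)=\int_\Omega u\,dx$ are conserved: for all $t\ge0$, $$\mathcal{M}(t)=\mathcal{M}(0),\qquad \mathcal{I}_1(t)=\mathcal{I}_1(0),\qquad \mathcal{I}_2(t)=\mathcal{I}_2(0).$$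
   Context: $B$ is complex-valued; $\rho,u,\phi$ are real-valued. $\omega,\kappa,\nu,\beta,q$ are given real constants with $q=\kappa+\frac{\nu(\kappa\nu-1)}{4(\beta-\nu^2)}$ (so $\beta\neq\nu^2$). $\Omega=[a,b]$ is a bounded interval, and periodic boundary conditions mean that all functions are $(b-a)$-periodic in $x$. $\mathrm{Re}$ denotes the real part and the bar complex conjugation. *)

theory Defs
  imports "HOL-Analysis.Analysis"
begin

text \<open>
  Functions of space and time are curried, \<open>f x t\<close>. Space-periodic functions live on the whole
  real line in \<open>x\<close>; only times \<open>t \<ge> 0\<close> are relevant, so the time derivative at \<open>t = 0\<close> is
  one-sided.
\<close>

definition dx :: "(real \<Rightarrow> real \<Rightarrow> 'a::real_normed_vector) \<Rightarrow> real \<Rightarrow> real \<Rightarrow> 'a" where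
  "dx f x t = vector_derivative (\<lambda>y. f y t) (at x)"

definition dt :: "(real \<Rightarrow> real \<Rightarrow> 'a::real_normed_vector) \<Rightarrow> real \<Rightarrow> real \<Rightarrow> 'a" where
  "dt f x t = vector_derivative (\<lambda>s. f x s) (at t within {0..})"

definition dx_exists :: "(real \<Rightarrow> real \<Rightarrow> 'a::real_normed_vector) \<Rightarrow> bool" where
  "dx_exists f \<longleftrightarrow> (\<forall>x. \<forall>t\<ge>0. (\<lambda>y. f y t) differentiable (at x))"

definition dt_exists :: "(real \<Rightarrow> real \<Rightarrow> 'a::real_normed_vector) \<Rightarrow> bool" where
  "dt_exists f \<longleftrightarrow> (\<forall>x. \<forall>t\<ge>0. (\<lambda>s. f x s) differentiable (at t within {0..}))"

definition jointly_continuous :: "(real \<Rightarrow> real \<Rightarrow> 'a::real_normed_vector) \<Rightarrow> bool" where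
  "jointly_continuous f \<longleftrightarrow> continuous_on (UNIV \<times> {0..}) (\<lambda>(x, t). f x t)"

definition C1 :: "(real \<Rightarrow> real \<Rightarrow> 'a::real_normed_vector) \<Rightarrow> bool" where
  "C1 f \<longleftrightarrow> jointly_continuous f \<and>
     dx_exists f \<and> jointly_continuous (dx f) \<and>
     dt_exists f \<and> jointly_continuous (dt f)"

text \<open>Twice continuously differentiable in \<open>x\<close>, once in \<open>t\<close>.\<close>

definition C21 :: "(real \<Rightarrow> real \<Rightarrow> 'a::real_normed_vector) \<Rightarrow> bool" where
  "C21 f \<longleftrightarrow> C1 f \<and> dx_exists (dx f) \<and> jointly_continuous (dx (dx f))"

text \<open>
  ``Sufficiently smooth'' is read as the regularity of a classical solution: exactly the
  derivatives occurring in the system exist and are jointly continuous (for \<open>B\<close> up to second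
  order in \<open>x\<close>), together with those of lower order.
\<close>

definition sufficiently_smooth ::
  "(real \<Rightarrow> real \<Rightarrow> complex) \<Rightarrow> (real \<Rightarrow> real \<Rightarrow> real) \<Rightarrow> (real \<Rightarrow> real \<Rightarrow> real) \<Rightarrow>
   (real \<Rightarrow> real \<Rightarrow> real) \<Rightarrow> bool" where
  "sufficiently_smooth B \<rho> u \<phi> \<longleftrightarrow> C21 B \<and> C1 \<rho> \<and> C1 u \<and> C1 \<phi>"

definition periodic_in_x :: "real \<Rightarrow> (real \<Rightarrow> real \<Rightarrow> 'a) \<Rightarrow> bool" where
  "periodic_in_x L f \<longleftrightarrow> (\<forall>x. \<forall>t\<ge>0. f (x + L) t = f x t)"

definition mass :: "real \<Rightarrow> real \<Rightarrow> (real \<Rightarrow> real \<Rightarrow> complex) \<Rightarrow> real \<Rightarrow> real" where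
  "mass a b B t = integral {a..b} (\<lambda>x. (cmod (B x t))\<^sup>2)"

definition linear_functional :: "real \<Rightarrow> real \<Rightarrow> (real \<Rightarrow> real \<Rightarrow> real) \<Rightarrow> real \<Rightarrow> real" where
  "linear_functional a b f t = integral {a..b} (\<lambda>x. f x t)"

end

theory Submission
  imports Defs
begin

text \<open>
  Each of the three densities satisfies a local conservation law, its time derivative being the
  space derivative of a periodic flux; integrating over one period gives the claim. For the mass,
  the potential term in the equation for \<open>B\<close> contributes a purely imaginary part to
  \<open>cnj B * dt B\<close>, and what remains, \<open>-2 * \<omega> * Im (cnj B * dx (dx B))\<close>, is the space
  derivative of \<open>-2 * \<omega> * Im (cnj B * dx B)\<close>, because \<open>cnj (dx B) * dx B\<close> is real.
\<close>

lemma dx_has_vector_derivative: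
  assumes "dx_exists f" "t \<ge> 0"
  shows "((\<lambda>y. f y t) has_vector_derivative dx f x t) (at x)"
  using assms by (simp add: dx_exists_def dx_def vector_derivative_works)

lemma dt_has_vector_derivative:
  assumes "dt_exists f" "t \<ge> 0"
  shows "((\<lambda>s. f x s) has_vector_derivative dt f x t) (at t within {0..})"
  using assms by (simp add: dt_exists_def dt_def vector_derivative_works)

text \<open>By the chain rule, shifting by \<open>L\<close> turns the derivative at
  \<open>x + L\<close> into a derivative at \<open>x\<close> of the shifted function, which is the
  function itself; derivatives are unique. The mass flux contains \<open>dx B\<close>, so its
  endpoint values must match as well.\<close>

lemma periodic_in_x_dx:
  assumes "dx_exists f" "periodic_in_x L f"
  shows "periodic_in_x L (dx f)"
  unfolding periodic_in_x_def
proof (intro allI impI)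
  fix x t :: real assume t: "t \<ge> 0"
  have "((\<lambda>y. y + L) has_vector_derivative 1) (at x)"
    by (auto intro!: derivative_eq_intros)
  from vector_diff_chain_at[OF this dx_has_vector_derivative[OF assms(1) t, of "x + L"]]
  have "((\<lambda>y. f y t) has_vector_derivative dx f (x + L) t) (at x)"
    using assms(2) t by (simp add: o_def periodic_in_x_def)
  with dx_has_vector_derivative[OF assms(1) t, of x]
  show "dx f (x + L) t = dx f x t"
    by (rule vector_derivative_unique_at[symmetric])
qed

lemma periodic_in_x_endpoints:
  assumes "periodic_in_x (b - a) f" "t \<ge> 0"
  shows "f b t = f a t"
  using assms(1)[unfolded periodic_in_x_def, rule_format, of t a] assms(2) by simp

text \<open>Differentiation under the integral expects the parameter, here time, as the first
  component of the pair.\<close>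

lemma jointly_continuous_swap:
  assumes "jointly_continuous f"
  shows "continuous_on ({0..} \<times> A) (\<lambda>(t, x). f x t)"
proof -
  have "continuous_on ({0..} \<times> A) ((\<lambda>(x, t). f x t) \<circ> prod.swap)"
    using assms unfolding jointly_continuous_def
    by (intro continuous_on_compose continuous_on_swap) (auto elim: continuous_on_subset)
  then show ?thesis by (simp add: o_def case_prod_unfold)
qed

lemma jointly_continuous_slice:
  assumes "jointly_continuous f" "t \<ge> 0"
  shows "continuous_on A (\<lambda>x. f x t)"
proof -
  have "continuous_on A ((\<lambda>(x, t). f x t) \<circ> (\<lambda>x. (x, t)))"
    using assms unfolding jointly_continuous_def
    by (intro continuous_on_compose continuous_intros) (auto elim: continuous_on_subset)
  then show ?thesis by (simp add: o_def)
qed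

text \<open>The function \<open>f'\<close> plays two roles: as time derivative of the density
  \<open>f\<close> it is the integrand after differentiating under the integral, and as space
  derivative of the flux \<open>F\<close> it integrates to \<open>F b t - F a t\<close>, which is
  zero.\<close>

lemma conservation_law:
  fixes f f' F :: "real \<Rightarrow> real \<Rightarrow> real"
  assumes "a \<le> b"
    and f: "jointly_continuous f" "jointly_continuous f'"
    and dt: "\<And>x t. t \<ge> 0 \<Longrightarrow> ((\<lambda>s. f x s) has_vector_derivative f' x t) (at t within {0..})"
    and dx: "\<And>x t. x \<in> {a..b} \<Longrightarrow> t \<ge> 0 \<Longrightarrow> ((\<lambda>y. F y t) has_vector_derivative f' x t) (at x)"
    and per: "\<And>t. t \<ge> 0 \<Longrightarrow> F b t = F a t"
    and "t \<ge> 0"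
  shows "integral {a..b} (\<lambda>x. f x t) = integral {a..b} (\<lambda>x. f x 0)"
proof -
  have deriv: "((\<lambda>s. integral {a..b} (\<lambda>x. f x s)) has_vector_derivative 0) (at t within {0..})"
    if t: "t \<in> {0..}" for t
  proof -
    have "((\<lambda>x. f' x t) has_integral F b t - F a t) {a..b}"
      using \<open>a \<le> b\<close> dx t
      by (intro fundamental_theorem_of_calculus) (auto intro: has_vector_derivative_at_within)
    then have "integral {a..b} (\<lambda>x. f' x t) = 0"
      using per t by (simp add: integral_unique)
    moreover have "((\<lambda>s. integral (cbox a b) (\<lambda>x. f x s)) has_vector_derivative
        integral (cbox a b) (\<lambda>x. f' x t)) (at t within {0..})"
      using t by (intro leibniz_rule_vector_derivative)
        (auto intro: dt jointly_continuous_swap f integrable_continuous_interval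
          jointly_continuous_slice)
    ultimately show ?thesis by simp
  qed
  \<comment> \<open>The derivative is taken within the convex set \<open>{0..}\<close>, one-sided at
    time 0, so constancy includes the initial time.\<close>
  obtain c where "\<And>s. s \<in> {0..} \<Longrightarrow> integral {a..b} (\<lambda>x. f x s) = c"
    using has_vector_derivative_zero_constant[OF convex_real_interval(1) deriv] by blast
  then show ?thesis using \<open>t \<ge> 0\<close> by simp
qed

text \<open>With \<open>f' = dt f\<close>, the continuity of the integrand comes from
  \<open>C1 f\<close>, and the equation identifies it with the derivative of the flux.\<close>

lemma linear_functional_conserved:
  assumes "a \<le> b" "C1 f" "dx_exists F" "periodic_in_x (b - a) F"
    and "\<And>x t. x \<in> {a..b} \<Longrightarrow> t \<ge> 0 \<Longrightarrow> dt f x t = dx F x t"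
    and "t \<ge> 0"
  shows "linear_functional a b f t = linear_functional a b f 0"
  unfolding linear_functional_def
  using assms by (intro conservation_law[where f' = "dt f" and F = F])
    (auto simp: C1_def dt_has_vector_derivative dx_has_vector_derivative
      intro: periodic_in_x_endpoints)

text \<open>The coupling to the other unknowns is absorbed into one real potential \<open>V\<close>,
  which leaves a linear Schroedinger equation for \<open>B\<close>.\<close>

lemma mass_conserved:
  fixes B :: "real \<Rightarrow> real \<Rightarrow> complex" and V :: "real \<Rightarrow> real \<Rightarrow> real"
  assumes "a \<le> b" and B: "C21 B" "periodic_in_x (b - a) B"
    and eq: "\<And>x t. x \<in> {a..b} \<Longrightarrow> t \<ge> 0 \<Longrightarrow>
      dt B x t = \<i> * (complex_of_real \<omega> * dx (dx B) x t - complex_of_real (V x t) * B x t)"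
    and "t \<ge> 0"
  shows "mass a b B t = mass a b B 0"
proof -
  have reg: "dx_exists B" "dx_exists (dx B)" "dt_exists B"
    "jointly_continuous B" "jointly_continuous (dt B)"
    using B(1) by (simp_all add: C21_def C1_def)
  define f' where "f' = (\<lambda>x t. 2 * Re (cnj (B x t) * dt B x t))"
  define F where "F = (\<lambda>x t. - 2 * \<omega> * Im (cnj (B x t) * dx B x t))"
  show ?thesis
    unfolding mass_def
  proof (rule conservation_law[where f' = f' and F = F])
    show "jointly_continuous (\<lambda>x t. (cmod (B x t))\<^sup>2)" "jointly_continuous f'"
      using reg unfolding jointly_continuous_def f'_def case_prod_unfold
      by (intro continuous_intros; simp)+
  next
    fix x t :: real assume t: "t \<ge> 0"
    note D = dt_has_vector_derivative[OF reg(3) t, of x]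
    \<comment> \<open>Writing the squared modulus as a product makes the product rule applicable;
      the two resulting terms are conjugate, hence the factor 2 in \<open>f'\<close>.\<close>
    have "((\<lambda>s. Re (B x s * cnj (B x s))) has_vector_derivative
        Re (B x t * cnj (dt B x t) + dt B x t * cnj (B x t))) (at t within {0..})"
      by (intro bounded_linear.has_vector_derivative[OF bounded_linear_Re]
        has_vector_derivative_mult has_vector_derivative_cnj D)
    then show "((\<lambda>s. (cmod (B x s))\<^sup>2) has_vector_derivative f' x t) (at t within {0..})"
      by (simp add: f'_def cmod_def flip: power2_eq_square)
  next
    fix x t :: real assume x: "x \<in> {a..b}" and t: "t \<ge> 0"
    have "((\<lambda>y. - 2 * \<omega> * Im (cnj (B y t) * dx B y t)) has_vector_derivative
        - 2 * \<omega> * Im (cnj (B x t) * dx (dx B) x t + cnj (dx B x t) * dx B x t)) (at x)"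
      by (intro bounded_linear.has_vector_derivative[OF bounded_linear_mult_right]
        bounded_linear.has_vector_derivative[OF bounded_linear_Im]
        has_vector_derivative_mult has_vector_derivative_cnj dx_has_vector_derivative reg t)
    \<comment> \<open>Inserting the equation, the potential contributes the real part of
      \<open>- \<i> * V x t * B x t * cnj (B x t)\<close>, which vanishes, and Re of
      \<open>\<i>\<close> times a number is minus its Im.\<close>
    moreover have "- 2 * \<omega> * Im (cnj (B x t) * dx (dx B) x t + cnj (dx B x t) * dx B x t) = f' x t"
      by (simp add: f'_def eq[OF x t] algebra_simps)
    ultimately show "((\<lambda>y. F y t) has_vector_derivative f' x t) (at x)"
      by (simp add: F_def)
  next
    show "F b t = F a t" if "t \<ge> 0" for t
      using periodic_in_x_endpoints[OF B(2) that]
        periodic_in_x_endpoints[OF periodic_in_x_dx[OF reg(1) B(2)] that]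
      by (simp add: F_def)
  qed (use assms in auto)
qed

theorem theorem2p2:
  fixes \<omega> \<kappa> \<nu> \<beta> q a b :: real
    and B :: "real \<Rightarrow> real \<Rightarrow> complex"
    and \<rho> u \<phi> :: "real \<Rightarrow> real \<Rightarrow> real"
    and B0 :: "real \<Rightarrow> complex"
    and \<rho>0 u0 :: "real \<Rightarrow> real"
  assumes "a < b"
    and "\<beta> \<noteq> \<nu>\<^sup>2"
    and "q = \<kappa> + \<nu> * (\<kappa> * \<nu> - 1) / (4 * (\<beta> - \<nu>\<^sup>2))"
    and "sufficiently_smooth B \<rho> u \<phi>"
    and "periodic_in_x (b - a) B" "periodic_in_x (b - a) \<rho>"
        "periodic_in_x (b - a) u" "periodic_in_x (b - a) \<phi>"
    and "\<And>x t. x \<in> {a..b} \<Longrightarrow> t \<ge> 0 \<Longrightarrow>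
           dt B x t = \<i> * (complex_of_real \<omega> * dx (dx B) x t
             - complex_of_real (\<kappa> * (u x t - (1/2) * \<nu> * \<rho> x t + q * \<phi> x t)) * B x t)"
    and "\<And>x t. x \<in> {a..b} \<Longrightarrow> t \<ge> 0 \<Longrightarrow>
           dt \<rho> x t = dx (\<lambda>y s. - u y s + \<nu> * \<rho> y s - \<kappa> * \<phi> y s) x t"
    and "\<And>x t. x \<in> {a..b} \<Longrightarrow> t \<ge> 0 \<Longrightarrow>
           dt u x t = dx (\<lambda>y s. - \<beta> * \<rho> y s + \<nu> * u y s + (1/2) * \<kappa> * \<nu> * \<phi> y s) x t"
    and "\<And>x t. x \<in> {a..b} \<Longrightarrow> t \<ge> 0 \<Longrightarrow>
           dt \<phi> x t = 2 * Re (cnj (B x t) * dt B x t)"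
    and "\<And>x. x \<in> {a..b} \<Longrightarrow> B x 0 = B0 x"
    and "\<And>x. x \<in> {a..b} \<Longrightarrow> \<rho> x 0 = \<rho>0 x"
    and "\<And>x. x \<in> {a..b} \<Longrightarrow> u x 0 = u0 x"
    and "\<And>x. x \<in> {a..b} \<Longrightarrow> \<phi> x 0 = (cmod (B0 x))\<^sup>2"
  shows "\<forall>t\<ge>0. mass a b B t = mass a b B 0
               \<and> linear_functional a b \<rho> t = linear_functional a b \<rho> 0
               \<and> linear_functional a b u t = linear_functional a b u 0"
proof (intro allI impI conjI)
  fix t :: real assume t: "t \<ge> 0"
  note smooth = assms(4)[unfolded sufficiently_smooth_def]
  have dx_ex: "dx_exists \<rho>" "dx_exists u" "dx_exists \<phi>"
    using smooth by (simp_all add: C1_def)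
  show "mass a b B t = mass a b B 0"
    \<comment> \<open>Unification with the equation for \<open>B\<close> instantiates
      \<open>V\<close> as \<open>\<kappa>\<close> times the real bracket.\<close>
    by (rule mass_conserved[OF _ _ assms(5) assms(9) t]) (use assms(1) smooth in auto)
  show "linear_functional a b \<rho> t = linear_functional a b \<rho> 0"
  \<comment> \<open>The flux is the expression under \<open>dx\<close> in the equation; it inherits
    differentiability and periodicity as a linear combination of \<open>\<rho>\<close>,
    \<open>u\<close> and \<open>\<phi>\<close>.\<close>
  proof (rule linear_functional_conserved[OF _ _ _ _ assms(10) t])
    show "dx_exists (\<lambda>y s. - u y s + \<nu> * \<rho> y s - \<kappa> * \<phi> y s)"
      using dx_ex by (simp add: dx_exists_def)
  qed (use assms(1,6-8) smooth in \<open>auto simp: periodic_in_x_def\<close>)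
  show "linear_functional a b u t = linear_functional a b u 0"
  proof (rule linear_functional_conserved[OF _ _ _ _ assms(11) t])
    show "dx_exists (\<lambda>y s. - \<beta> * \<rho> y s + \<nu> * u y s + (1/2) * \<kappa> * \<nu> * \<phi> y s)"
      using dx_ex by (simp add: dx_exists_def)
  qed (use assms(1,6-8) smooth in \<open>auto simp: periodic_in_x_def\<close>)
qed

end
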